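(* If $P$ is a reflexive cone of a Banach space $X$ with a closed, bounded base $B$, then $P$ does not contain an infinite dimensional, closed cone $K$ with the continuous projection property.
   Context: All spaces are real. $B_X$ is the closed unit ball of $X$. A cone of $X$ is a nonempty convex set $P\subseteq X$ with $\lambda P\subseteq P$ for every real $\lambda\ge 0$; it is pointed if $P\cap(-P)=\{0\}$. $P$ is reflexive if $P\cap B_X$ is weakly compact. A base for $P$ is a convex subset $B$ of $P$ such that for each $x\in P$, $x\neq 0$, there is a unique real number $f(x)>0$ with $x/f(x)\in B$ (a cone with a base is pointed). A cone $K$ is infinite dimensional if the subspace $K-K$ is infinite dimensional. Continuous projection property: let $Y$ be a normed space ordered by a pointed cone $K$ (with $x\le y\iff y-x\in K$). A point $x_0\in K\setminus\{0\}$ is an extremal point of $K$ if for any $x\in Y$, $0\le x\le x_0$ implies $x=\lambda x_0$ for some real $\lambda$. An extremal point $x_0$ of $K$ admits a positive projection if there is a linear, continuous, positive (i.e. mapping $K$ into $K$) projection $P_{x_0}$ of $Y$ onto the one dimensional subspace $[x_0]$ generated by $x_0$ such that $P_{x_0}(x)\le x$ for any $x\in K$. $Y$ (equivalently, the cone $K$) has the continuous projection property if every extremal point of $K$ admits a positive projection. For closed $K$, this property of $Y$ is equivalent to the same property of the subspace $K-K$ (with the induced norm) ordered by $K$; in the claim it is understood for $X$ ordered by $K$. *)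

theory Defs
  imports "HOL-Analysis.Analysis"
begin

definition weak_topology :: "'a::real_normed_vector topology" where
  "weak_topology = topology_generated_by
     {f -` U | (f :: 'a \<Rightarrow> real) U. bounded_linear f \<and> open U}"

definition reflexive_cone :: "'a::real_normed_vector set \<Rightarrow> bool" where
  "reflexive_cone P \<longleftrightarrow> convex_cone P \<and> compactin weak_topology (P \<inter> cball 0 1)"

definition base_of_cone :: "'a::real_vector set \<Rightarrow> 'a set \<Rightarrow> bool" where
  "base_of_cone B P \<longleftrightarrow> B \<subseteq> P \<and> convex B \<and>
     (\<forall>x\<in>P. x \<noteq> 0 \<longrightarrow> (\<exists>!t::real. t > 0 \<and> x /\<^sub>R t \<in> B))"

definition cone_le :: "'a::real_vector set \<Rightarrow> 'a \<Rightarrow> 'a \<Rightarrow> bool" where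
  "cone_le K x y \<longleftrightarrow> y - x \<in> K"

(* A finite spanning set S is not required to lie inside K - K; this makes no difference,
   since subspaces of finite-dimensional spaces are finite dimensional. *)
definition infinite_dimensional_cone :: "'a::real_vector set \<Rightarrow> bool" where
  "infinite_dimensional_cone K \<longleftrightarrow>
     \<not> (\<exists>S. finite S \<and> {x - y | x y. x \<in> K \<and> y \<in> K} \<subseteq> span S)"

definition extremal_point :: "'a::real_vector set \<Rightarrow> 'a \<Rightarrow> bool" where
  "extremal_point K x0 \<longleftrightarrow> x0 \<in> K - {0} \<and>
     (\<forall>x. cone_le K 0 x \<and> cone_le K x x0 \<longrightarrow> (\<exists>c::real. x = c *\<^sub>R x0))"

definition admits_positive_projection :: "'a::real_normed_vector set \<Rightarrow> 'a \<Rightarrow> bool" where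
  "admits_positive_projection K x0 \<longleftrightarrow>
     (\<exists>p :: 'a \<Rightarrow> 'a. bounded_linear p \<and> p \<circ> p = p \<and> range p = span {x0} \<and>
        p ` K \<subseteq> K \<and> (\<forall>x\<in>K. cone_le K (p x) x))"

(* The notion is meant for pointed cones K. Pointedness is not repeated here: every cone
   contained in a cone that has a base is pointed. *)
definition continuous_projection_property :: "'a::real_normed_vector set \<Rightarrow> bool" where
  "continuous_projection_property K \<longleftrightarrow>
     (\<forall>x0. extremal_point K x0 \<longrightarrow> admits_positive_projection K x0)"

end

theory Submission
  imports Defs
begin

text \<open>
  Let \<open>C = B \<inter> K\<close>. By Mazur's theorem, a consequence of Hahn--Banach separation, \<open>C\<close> is a
  weakly closed subset of a multiple of the weakly compact set \<open>P \<inter> cball 0 1\<close>; hence \<open>C\<close> is a weakly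
  compact convex base of \<open>K\<close>. Suppose \<open>K \<noteq> {0}\<close>. The extreme points of a base span extremal rays, so every extreme
  point \<open>e\<close> of \<open>C\<close> has a positive projection \<open>\<pi> e\<close> onto its ray with \<open>\<pi> e x \<le> x\<close> on \<open>K\<close>.

  Consider \<open>D = {z \<in> C. \<pi> e z = 0 for all extreme points e of C}\<close>. As the projections are positive
  and \<open>K\<close> is pointed, \<open>D\<close> is a closed face of \<open>C\<close>. If it were nonempty, then the Krein--Milman theorem
  would give an extreme point \<open>e\<close> of \<open>D\<close>; since \<open>D\<close> is a face, \<open>e\<close> is an extreme point of \<open>C\<close>, and
  \<open>\<pi> e e = e \<noteq> 0\<close> contradicts \<open>e \<in> D\<close>. So \<open>D\<close> is empty, that is, \<open>C\<close> is covered by the weakly open sets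
  \<open>{z. \<pi> e z \<noteq> 0}\<close>, and by compactness finitely many extreme points, forming a set \<open>F\<close>, suffice.

  Now let \<open>z \<in> K\<close> and subtract from \<open>z\<close> its projections onto the rays of \<open>F\<close>, one after the other.
  Since \<open>\<pi> e x \<le> x\<close>, the remainder stays in \<open>K\<close>, and all projections for \<open>F\<close> vanish on it. By the
  choice of \<open>F\<close> no positive multiple of the remainder lies in the base \<open>C\<close>, so the remainder is \<open>0\<close>
  and \<open>z \<in> span F\<close>. Therefore \<open>K\<close> is finite dimensional.

  The Hahn--Banach theorem itself is obtained in its sublinear form: a minimal sublinear
  functional is linear, and Zorn's lemma provides a minimal one below any given one.
\<close>

section \<open>Zorn's lemma for minimal elements\<close>

lemma Zorn_minimal:
  fixes A :: "'b::order set"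
  assumes "A \<noteq> {}"
    and chain: "\<And>C. C \<noteq> {} \<Longrightarrow> C \<subseteq> A \<Longrightarrow> (\<And>x y. x \<in> C \<Longrightarrow> y \<in> C \<Longrightarrow> x \<le> y \<or> y \<le> x) \<Longrightarrow>
                     \<exists>u\<in>A. \<forall>a\<in>C. u \<le> a"
  shows "\<exists>m\<in>A. \<forall>a\<in>A. a \<le> m \<longrightarrow> a = m"
proof -
  have "\<exists>m\<in>A. \<forall>a\<in>A. m \<ge> a \<longrightarrow> a = m"
  proof (rule predicate_Zorn)
    show "partial_order_on A (relation_of (\<ge>) A)"
      by (rule partial_order_on_relation_ofI) auto
  next
    fix C assume C: "C \<in> Chains (relation_of (\<ge>) A)"
    show "\<exists>u\<in>A. \<forall>a\<in>C. a \<ge> u"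
    proof (cases "C = {}")
      case True
      with assms(1) show ?thesis by auto
    next
      case False
      with C show ?thesis
        by (intro chain) (auto simp: Chains_def relation_of_def)
    qed
  qed
  then show ?thesis by auto
qed

section \<open>The Hahn--Banach theorem\<close>

definition sublinear :: "('a::real_vector \<Rightarrow> real) \<Rightarrow> bool" where
  "sublinear q \<longleftrightarrow> (\<forall>x y. q (x + y) \<le> q x + q y) \<and> (\<forall>c\<ge>0. \<forall>x. q (c *\<^sub>R x) = c * q x)"

lemma sublinearD:
  assumes "sublinear q"
  shows "q (x + y) \<le> q x + q y" and "c \<ge> 0 \<Longrightarrow> q (c *\<^sub>R x) = c * q x"
    and "q 0 = 0" and "- q (- x) \<le> q x"
proof -
  show add: "q (x + y) \<le> q x + q y" for x y
    using assms by (simp add: sublinear_def)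
  show "c \<ge> 0 \<Longrightarrow> q (c *\<^sub>R x) = c * q x"
    using assms by (simp add: sublinear_def)
  have "q (0 *\<^sub>R x) = 0 * q x"
    using assms unfolding sublinear_def by (metis order_refl)
  then show zero: "q 0 = 0" by simp
  show "- q (- x) \<le> q x"
    using add[of x "- x"] zero by simp
qed

text \<open>
  The three infima needed below, over a chain of functionals, along a ray, and over a convex set,
  are all sublinear because the family is directed in this sense: the sum of two members is bounded
  below by a single member evaluated at the sum of the arguments, and likewise for dilations.
\<close>

lemma sublinear_INF:
  fixes \<phi> :: "'i \<Rightarrow> 'a::real_vector \<Rightarrow> real"
  assumes "I \<noteq> {}"
    and bdd: "\<And>x. bdd_below ((\<lambda>i. \<phi> i x) ` I)"
    and add: "\<And>i j x y. i \<in> I \<Longrightarrow> j \<in> I \<Longrightarrow> \<exists>k\<in>I. \<phi> k (x + y) \<le> \<phi> i x + \<phi> j y"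
    and scale: "\<And>i c x. i \<in> I \<Longrightarrow> c > 0 \<Longrightarrow> \<exists>k\<in>I. \<phi> k (c *\<^sub>R x) \<le> c * \<phi> i x"
  shows "sublinear (\<lambda>x. INF i\<in>I. \<phi> i x)"
proof -
  define Q where "Q x = (INF i\<in>I. \<phi> i x)" for x
  have lower: "Q x \<le> \<phi> i x" if "i \<in> I" for i x
    unfolding Q_def using bdd that by (rule cINF_lower)
  have greatest: "m \<le> Q x" if "\<And>i. i \<in> I \<Longrightarrow> m \<le> \<phi> i x" for m x
    unfolding Q_def using \<open>I \<noteq> {}\<close> that by (rule cINF_greatest)
  have Q_add: "Q (x + y) \<le> Q x + Q y" for x y
  proof -
    have "Q (x + y) - \<phi> j y \<le> Q x" if j: "j \<in> I" for j
    proof (rule greatest)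
      fix i assume "i \<in> I"
      then obtain k where "k \<in> I" "\<phi> k (x + y) \<le> \<phi> i x + \<phi> j y"
        using add j by blast
      with lower[of k "x + y"] show "Q (x + y) - \<phi> j y \<le> \<phi> i x" by simp
    qed
    then have "Q (x + y) - Q x \<le> Q y"
      by (intro greatest) (simp add: algebra_simps)
    then show ?thesis by simp
  qed
  have Q_le: "Q (c *\<^sub>R x) \<le> c * Q x" if c: "c > 0" for c x
  proof -
    have "Q (c *\<^sub>R x) / c \<le> Q x"
    proof (rule greatest)
      fix i assume "i \<in> I"
      then obtain k where "k \<in> I" "\<phi> k (c *\<^sub>R x) \<le> c * \<phi> i x"
        using scale c by blast
      with lower[of k "c *\<^sub>R x"] show "Q (c *\<^sub>R x) / c \<le> \<phi> i x"
        using c by (simp add: field_simps)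
    qed
    then show ?thesis using c by (simp add: field_simps)
  qed
  have Q_scale: "Q (c *\<^sub>R x) = c * Q x" if c: "c > 0" for c x
  proof (rule antisym)
    have "Q ((1 / c) *\<^sub>R (c *\<^sub>R x)) \<le> 1 / c * Q (c *\<^sub>R x)"
      by (rule Q_le) (use c in simp)
    then show "c * Q x \<le> Q (c *\<^sub>R x)" using c by (simp add: field_simps)
  qed (rule Q_le[OF c])
  have "Q 0 = 0"
    using Q_scale[of 2 0] by simp
  then have "sublinear Q"
    unfolding sublinear_def using Q_add Q_scale by (metis less_eq_real_def mult_zero_left scaleR_zero_left)
  then show ?thesis by (simp add: Q_def[abs_def])
qed

text \<open>
  For a fixed \<open>y\<close> the functional \<open>inf {q (x + t y) - t q y | t \<ge> 0}\<close> is sublinear and at most \<open>q\<close>.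
  If \<open>q\<close> is minimal they agree, and \<open>t = 1\<close> yields the missing inequality \<open>q x + q y \<le> q (x + y)\<close>.
\<close>

lemma minimal_sublinear_imp_linear:
  fixes q :: "'a::real_vector \<Rightarrow> real"
  assumes q: "sublinear q" and minimal: "\<And>r. sublinear r \<Longrightarrow> r \<le> q \<Longrightarrow> r = q"
  shows "linear q"
proof -
  note q_add = sublinearD(1)[OF q] and q_scale = sublinearD(2)[OF q]
  have superadd: "q x + q y \<le> q (x + y)" for x y
  proof -
    define \<phi> where "\<phi> t x = q (x + t *\<^sub>R y) - t * q y" for t x
    define r where "r x = (INF t\<in>{0..}. \<phi> t x)" for x
    have bdd: "bdd_below ((\<lambda>t. \<phi> t x) ` {0..})" for x
    proof (rule bdd_belowI2)
      fix t :: real assume "t \<in> {0..}"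
      then show "- q (- x) \<le> \<phi> t x"
        using q_add[of "x + t *\<^sub>R y" "- x"] q_scale[of t y] by (simp add: \<phi>_def)
    qed
    have "sublinear r"
      unfolding r_def
    proof (rule sublinear_INF[OF _ bdd])
      fix s t :: real and u v assume "s \<in> {0..}" "t \<in> {0..}"
      moreover have "\<phi> (s + t) (u + v) \<le> \<phi> s u + \<phi> t v"
        using q_add[of "u + s *\<^sub>R y" "v + t *\<^sub>R y"] by (simp add: \<phi>_def algebra_simps)
      ultimately show "\<exists>k\<in>{0..}. \<phi> k (u + v) \<le> \<phi> s u + \<phi> t v"
        by (intro bexI[of _ "s + t"]) auto
    next
      fix t c :: real and u assume "t \<in> {0..}" "0 < c"
      moreover from this have "\<phi> (c * t) (c *\<^sub>R u) \<le> c * \<phi> t u"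
        using q_scale[of c "u + t *\<^sub>R y"] by (simp add: \<phi>_def algebra_simps)
      ultimately show "\<exists>k\<in>{0..}. \<phi> k (c *\<^sub>R u) \<le> c * \<phi> t u"
        by (intro bexI[of _ "c * t"]) auto
    qed auto
    moreover have r_le: "r z \<le> \<phi> t z" if "t \<ge> 0" for t z
      unfolding r_def using bdd that by (intro cINF_lower) auto
    have "r \<le> q"
      using r_le[of 0] by (simp add: le_fun_def \<phi>_def)
    ultimately have "r = q" by (intro minimal)
    with r_le[of 1 x] show ?thesis by (simp add: \<phi>_def)
  qed
  have add: "q (x + y) = q x + q y" for x y
    using superadd[of x y] q_add[of x y] by simp
  have neg: "q (- x) = - q x" for x
    using add[of x "- x"] sublinearD(3)[OF q] by simp
  show ?thesis
  proof (rule linearI)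
    fix c x
    show "q (c *\<^sub>R x) = c *\<^sub>R q x"
    proof (cases "c \<ge> 0")
      case True
      then show ?thesis by (simp add: q_scale)
    next
      case False
      then show ?thesis
        using q_scale[of "- c" x] neg[of "c *\<^sub>R x"] by simp
    qed
  qed (rule add)
qed

theorem Hahn_Banach_sublinear:
  fixes p :: "'a::real_vector \<Rightarrow> real"
  assumes p: "sublinear p"
  obtains f where "linear f" "\<And>x. f x \<le> p x"
proof -
  have "\<exists>q\<in>{q. sublinear q \<and> q \<le> p}. \<forall>r\<in>{q. sublinear q \<and> q \<le> p}. r \<le> q \<longrightarrow> r = q"
  proof (rule Zorn_minimal)
    show "{q. sublinear q \<and> q \<le> p} \<noteq> {}" using p by auto
  next
    fix C :: "('a \<Rightarrow> real) set"
    assume ne: "C \<noteq> {}" and C: "C \<subseteq> {q. sublinear q \<and> q \<le> p}"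
      and chain: "\<And>q r. q \<in> C \<Longrightarrow> r \<in> C \<Longrightarrow> q \<le> r \<or> r \<le> q"
    define u where "u x = (INF q\<in>C. q x)" for x
    have bdd: "bdd_below ((\<lambda>q. q x) ` C)" for x
    proof (rule bdd_belowI2)
      fix q assume "q \<in> C"
      with C have "sublinear q" "q (- x) \<le> p (- x)" by (auto simp: le_fun_def)
      then show "- p (- x) \<le> q x" using sublinearD(4)[of q x] by simp
    qed
    have "sublinear u"
      unfolding u_def
    proof (rule sublinear_INF[OF ne bdd])
      fix q r x y assume qr: "q \<in> C" "r \<in> C"
      from chain[OF this] show "\<exists>k\<in>C. k (x + y) \<le> q x + r y"
      proof
        assume "q \<le> r"
        then have "q y \<le> r y" by (simp add: le_fun_def)
        moreover have "q (x + y) \<le> q x + q y"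
          using qr C by (blast intro: sublinearD(1))
        ultimately show ?thesis using qr by (intro bexI[of _ q]) auto
      next
        assume "r \<le> q"
        then have "r x \<le> q x" by (simp add: le_fun_def)
        moreover have "r (x + y) \<le> r x + r y"
          using qr C by (blast intro: sublinearD(1))
        ultimately show ?thesis using qr by (intro bexI[of _ r]) auto
      qed
    next
      fix q and c :: real and x assume "q \<in> C" "c > 0"
      then show "\<exists>k\<in>C. k (c *\<^sub>R x) \<le> c * q x"
        using C by (intro bexI[of _ q]) (auto simp: sublinearD(2))
    qed
    moreover have u_le: "u \<le> q" if "q \<in> C" for q
      unfolding u_def le_fun_def using bdd that by (auto intro: cINF_lower)
    moreover have "u \<le> p"
      using ne C u_le by (blast intro: order_trans)
    ultimately show "\<exists>u\<in>{q. sublinear q \<and> q \<le> p}. \<forall>q\<in>C. u \<le> q" by auto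
  qed
  then obtain q where q: "sublinear q" "q \<le> p"
    and minimal: "\<And>r. sublinear r \<Longrightarrow> r \<le> p \<Longrightarrow> r \<le> q \<Longrightarrow> r = q"
    by blast
  have "linear q"
    using q minimal by (intro minimal_sublinear_imp_linear) (auto intro: order_trans)
  with q that show thesis by (auto simp: le_fun_def)
qed

text \<open>
  The functional \<open>p x = inf {norm (x + t a) - t r | t \<ge> 0, a \<in> A}\<close> is sublinear because \<open>A\<close> is convex.
  Taking \<open>t = 0\<close> gives \<open>p \<le> norm\<close>, so a linear functional below \<open>p\<close> is continuous; \<open>t = 1\<close> gives
  \<open>p (- a) \<le> - r\<close>, so it is at least \<open>r\<close> on \<open>A\<close>.
\<close>

theorem convex_separation_from_zero:
  fixes A :: "'a::real_normed_vector set"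
  assumes "convex A" and r: "\<And>a. a \<in> A \<Longrightarrow> r \<le> norm a"
  obtains f :: "'a \<Rightarrow> real" where "bounded_linear f" "\<And>a. a \<in> A \<Longrightarrow> r \<le> f a"
proof (cases "A = {}")
  case True
  then show thesis using that[of "\<lambda>_. 0"] by (simp)
next
  case False
  define I where "I = {0::real..} \<times> A"
  define \<phi> where "\<phi> i x = norm (x + fst i *\<^sub>R snd i) - fst i * r" for i and x :: 'a
  define p where "p x = (INF i\<in>I. \<phi> i x)" for x
  have bdd: "bdd_below ((\<lambda>i. \<phi> i x) ` I)" for x
  proof (rule bdd_belowI2)
    fix i assume "i \<in> I"
    then obtain t a where i: "i = (t, a)" "t \<ge> 0" "a \<in> A" by (auto simp: I_def)
    have "t * r \<le> norm (t *\<^sub>R a)" using i r by (simp add: mult_left_mono)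
    also have "\<dots> \<le> norm (x + t *\<^sub>R a) + norm x"
      using norm_triangle_ineq[of "x + t *\<^sub>R a" "- x"] by simp
    finally show "- norm x \<le> \<phi> i x" by (simp add: \<phi>_def i)
  qed
  have "sublinear p"
    unfolding p_def
  proof (rule sublinear_INF[OF _ bdd])
    show "I \<noteq> {}" using False by (auto simp: I_def)
  next
    fix i j and x y :: 'a assume "i \<in> I" "j \<in> I"
    then obtain s a t b where i: "i = (s, a)" "s \<ge> 0" "a \<in> A" and j: "j = (t, b)" "t \<ge> 0" "b \<in> A"
      by (auto simp: I_def)
    have "\<exists>c\<in>A. (s + t) *\<^sub>R c = s *\<^sub>R a + t *\<^sub>R b"
    proof (cases "s + t = 0")
      case True
      with i j have "s = 0" "t = 0" by auto
      with i show ?thesis by auto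
    next
      case False
      then have "(s / (s + t)) *\<^sub>R a + (t / (s + t)) *\<^sub>R b \<in> A"
        using i j by (intro convexD[OF \<open>convex A\<close>]) (auto simp: add_divide_distrib[symmetric])
      moreover have "(s + t) *\<^sub>R ((s / (s + t)) *\<^sub>R a + (t / (s + t)) *\<^sub>R b) = s *\<^sub>R a + t *\<^sub>R b"
        using False by (simp add: scaleR_right_distrib)
      ultimately show ?thesis by blast
    qed
    then obtain c where c: "c \<in> A" "(s + t) *\<^sub>R c = s *\<^sub>R a + t *\<^sub>R b" by blast
    have "norm (x + y + (s + t) *\<^sub>R c) \<le> norm (x + s *\<^sub>R a) + norm (y + t *\<^sub>R b)"
      using norm_triangle_ineq[of "x + s *\<^sub>R a" "y + t *\<^sub>R b"] by (simp add: c(2) ac_simps)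
    then have "\<phi> (s + t, c) (x + y) \<le> \<phi> i x + \<phi> j y"
      by (simp add: \<phi>_def i j algebra_simps)
    then show "\<exists>k\<in>I. \<phi> k (x + y) \<le> \<phi> i x + \<phi> j y"
      using c i j by (intro bexI[of _ "(s + t, c)"]) (auto simp: I_def)
  next
    fix i and c :: real and x :: 'a assume "i \<in> I" "c > 0"
    then obtain t a where i: "i = (t, a)" "t \<ge> 0" "a \<in> A" by (auto simp: I_def)
    have "norm (c *\<^sub>R x + (c * t) *\<^sub>R a) = c * norm (x + t *\<^sub>R a)"
      using \<open>c > 0\<close> norm_scaleR[of c "x + t *\<^sub>R a"] by (simp add: scaleR_right_distrib)
    then have "\<phi> (c * t, a) (c *\<^sub>R x) \<le> c * \<phi> i x"
      by (simp add: \<phi>_def i algebra_simps)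
    then show "\<exists>k\<in>I. \<phi> k (c *\<^sub>R x) \<le> c * \<phi> i x"
      using i \<open>c > 0\<close> by (intro bexI[of _ "(c * t, a)"]) (auto simp: I_def)
  qed
  then obtain f where f: "linear f" "\<And>x. f x \<le> p x"
    using Hahn_Banach_sublinear by blast
  have f_le: "f x \<le> \<phi> i x" if "i \<in> I" for i x
    using f(2)[of x] cINF_lower[OF bdd that, of x] by (simp add: p_def)
  have f_norm: "f x \<le> norm x" for x
    using False f_le[of "(0, _)" x] by (auto simp: I_def \<phi>_def)
  have "bounded_linear f"
  proof (rule bounded_linear_intro)
    show "norm (f x) \<le> norm x * 1" for x
      using f_norm[of x] f_norm[of "- x"] linear_neg[OF f(1), of x] by (simp add: abs_le_iff)
  qed (simp_all add: linear_add[OF f(1)] linear_scale[OF f(1)])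
  moreover have "r \<le> f a" if "a \<in> A" for a
    using f_le[of "(1, a)" "- a"] that linear_neg[OF f(1), of a] by (simp add: I_def \<phi>_def)
  ultimately show thesis using that by blast
qed

lemma bounded_linear_separates_points:
  fixes x y :: "'a::real_normed_vector"
  assumes "x \<noteq> y"
  obtains f :: "'a \<Rightarrow> real" where "bounded_linear f" "f x \<noteq> f y"
proof -
  obtain f :: "'a \<Rightarrow> real" where f: "bounded_linear f" "\<And>a. a \<in> {x - y} \<Longrightarrow> norm (x - y) \<le> f a"
    using convex_separation_from_zero[of "{x - y}" "norm (x - y)"] by auto
  then have "f (x - y) > 0"
    using assms less_le_trans[of 0 "norm (x - y)" "f (x - y)"] by simp
  then have "f x \<noteq> f y"
    using linear_diff[OF bounded_linear.linear[OF f(1)], of x y] by simp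
  with f(1) that show thesis by blast
qed

section \<open>Weak topology and extreme points\<close>

lemma topspace_weak_topology [simp]: "topspace (weak_topology :: 'a::real_normed_vector topology) = UNIV"
proof -
  have "(\<lambda>_. 0) -` UNIV \<in> {f -` U | (f :: 'a \<Rightarrow> real) U. bounded_linear f \<and> open U}"
    using bounded_linear_zero open_UNIV by blast
  then show ?thesis
    unfolding weak_topology_def topology_generated_by_topspace by auto
qed

lemma openin_weak_topology_vimage:
  fixes f :: "'a::real_normed_vector \<Rightarrow> real"
  assumes "bounded_linear f" "open U"
  shows "openin weak_topology (f -` U)"
proof -
  have "f -` U \<in> {f -` U | (f :: 'a \<Rightarrow> real) U. bounded_linear f \<and> open U}"
    using assms by auto
  then show ?thesis
    unfolding weak_topology_def by (rule topology_generated_by_Basis)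
qed

lemma continuous_map_weak_real:
  fixes f :: "'a::real_normed_vector \<Rightarrow> real"
  assumes "bounded_linear f"
  shows "continuous_map weak_topology euclidean f"
  unfolding continuous_map_def using openin_weak_topology_vimage[OF assms] by (simp add: vimage_def)

lemma continuous_map_weak_weak:
  fixes g :: "'a::real_normed_vector \<Rightarrow> 'b::real_normed_vector"
  assumes "bounded_linear g"
  shows "continuous_map weak_topology weak_topology g"
proof -
  have "openin weak_topology (g -` (f -` U))" if "bounded_linear f" "open U" for f :: "'b \<Rightarrow> real" and U
    using openin_weak_topology_vimage[OF bounded_linear_compose[OF that(1) assms] that(2)]
    by (simp add: vimage_def)
  moreover have "\<Union> {f -` U | (f :: 'b \<Rightarrow> real) U. bounded_linear f \<and> open U} = UNIV"
    using topspace_weak_topology[where 'a='b]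
    unfolding weak_topology_def topology_generated_by_topspace .
  ultimately show ?thesis
    by (subst (2) weak_topology_def, intro continuous_on_generated_topo) auto
qed

text \<open>Mazur: a point outside a closed convex set has a separating functional, hence a weakly open
  neighbourhood missing the set.\<close>

theorem closed_convex_imp_weakly_closed:
  fixes A :: "'a::real_normed_vector set"
  assumes "closed A" "convex A"
  shows "closedin weak_topology A"
proof -
  have "\<exists>V. openin weak_topology V \<and> x \<in> V \<and> V \<subseteq> - A" if "x \<notin> A" for x
  proof -
    from that \<open>closed A\<close> obtain e where e: "e > 0" "ball x e \<subseteq> - A"
      by (metis ComplI open_Compl open_contains_ball)
    have "e \<le> norm b" if "b \<in> (\<lambda>a. a - x) ` A" for b
    proof -
      from that obtain a where "a \<in> A" "b = a - x" by auto
      moreover from \<open>a \<in> A\<close> e have "a \<notin> ball x e" by auto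
      ultimately show ?thesis by (simp add: dist_norm norm_minus_commute)
    qed
    moreover have "convex ((\<lambda>a. a - x) ` A)"
      using \<open>convex A\<close> by (rule convex_translation_subtract)
    ultimately obtain f :: "'a \<Rightarrow> real" where
      f: "bounded_linear f" "\<And>b. b \<in> (\<lambda>a. a - x) ` A \<Longrightarrow> e \<le> f b"
      using convex_separation_from_zero by blast
    have "f a \<ge> f x + e" if "a \<in> A" for a
      using f(2)[of "a - x"] that by (simp add: bounded_linear.linear[OF f(1)] linear_diff)
    then have "f -` {..< f x + e} \<subseteq> - A" by force
    moreover have "x \<in> f -` {..< f x + e}" using e by simp
    moreover have "openin weak_topology (f -` {..< f x + e})"
      by (rule openin_weak_topology_vimage[OF f(1)]) simp
    ultimately show ?thesis by blast
  qed
  then have "openin weak_topology (- A)"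
    by (subst openin_subopen) auto
  then show ?thesis by (simp add: closedin_def Compl_eq_Diff_UNIV)
qed

lemma weakly_compact_closed_convex_subset:
  fixes S :: "'a::real_normed_vector set"
  assumes "compactin weak_topology S" "T \<subseteq> S" "closed T" "convex T"
  shows "compactin weak_topology T"
  using closed_compactin[OF assms(1,2) closed_convex_imp_weakly_closed[OF assms(3,4)]] .

text \<open>
  The existence part of the Krein--Milman theorem. A minimal nonempty closed face is a single point:
  if a functional separates two of its points, the points where the functional is smallest form a
  smaller closed face.
\<close>

theorem weakly_compact_convex_has_extreme_point:
  fixes S :: "'a::real_normed_vector set"
  assumes S: "compactin weak_topology S" "closed S" "convex S" "S \<noteq> {}"
  obtains e where "e extreme_point_of S"
proof -
  define \<F> where "\<F> = {F. F face_of S \<and> closed F \<and> F \<noteq> {}}"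
  have "\<exists>F\<in>\<F>. \<forall>G\<in>\<F>. G \<subseteq> F \<longrightarrow> G = F"
  proof (rule Zorn_minimal)
    show "\<F> \<noteq> {}"
      using S face_of_refl by (auto simp: \<F>_def)
  next
    fix \<C> assume ne: "\<C> \<noteq> {}" and \<C>: "\<C> \<subseteq> \<F>"
      and chain: "\<And>F G. F \<in> \<C> \<Longrightarrow> G \<in> \<C> \<Longrightarrow> F \<subseteq> G \<or> G \<subseteq> F"
    have face: "F face_of S" "closed F" "F \<noteq> {}" "closedin weak_topology F" if "F \<in> \<C>" for F
      using that \<C> face_of_imp_convex[of F S] closed_convex_imp_weakly_closed[of F]
      by (auto simp: \<F>_def)
    have "S \<inter> \<Inter>\<G> \<noteq> {}" if "finite \<G>" "\<G> \<subseteq> \<C>" for \<G>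
    proof (cases "\<G> = {}")
      case True
      with S show ?thesis by simp
    next
      case False
      \<comment> \<open>In a finite chain the intersection is the smallest member.\<close>
      have "F \<inter> G \<in> \<G>" if "F \<in> \<G>" "G \<in> \<G>" for F G
        using chain[of F G] that \<open>\<G> \<subseteq> \<C>\<close>
        by (metis inf.absorb1 inf.absorb2 subsetD)
      with \<open>finite \<G>\<close> False have "\<Inter>\<G> \<in> \<G>" by (rule finite_Inf_in)
      with that face[of "\<Inter>\<G>"] face_of_imp_subset[of "\<Inter>\<G>" S] show ?thesis by blast
    qed
    then have "S \<inter> \<Inter>\<C> \<noteq> {}"
      using S(1) face(4) by (simp add: compactin_fip)
    moreover have "\<Inter>\<C> face_of S" "closed (\<Inter>\<C>)"
      using ne face by (auto intro: face_of_Inter)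
    ultimately have "\<Inter>\<C> \<in> \<F>" by (auto simp: \<F>_def)
    then show "\<exists>G\<in>\<F>. \<forall>F\<in>\<C>. G \<subseteq> F" by (intro bexI[of _ "\<Inter>\<C>"]) auto
  qed
  then obtain F where F: "F \<in> \<F>" and minimal: "\<And>G. G \<in> \<F> \<Longrightarrow> G \<subseteq> F \<Longrightarrow> G = F"
    by blast
  from F have face: "F face_of S" and "closed F" "F \<noteq> {}" by (auto simp: \<F>_def)
  have "convex F" using face by (rule face_of_imp_convex)
  have "x = y" if xy: "x \<in> F" "y \<in> F" for x y
  proof (rule ccontr)
    assume "x \<noteq> y"
    then obtain f :: "'a \<Rightarrow> real" where f: "bounded_linear f" "f x \<noteq> f y"
      using bounded_linear_separates_points by blast
    interpret f: bounded_linear f by (rule f(1))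
    have "compactin weak_topology F"
      using weakly_compact_closed_convex_subset[OF S(1) face_of_imp_subset[OF face] \<open>closed F\<close> \<open>convex F\<close>] .
    then have "compact (f ` F)"
      using image_compactin[OF _ continuous_map_weak_real[OF f(1)]] by simp
    then obtain z where z: "z \<in> F" "\<And>w. w \<in> F \<Longrightarrow> f z \<le> f w"
      using compact_attains_inf[of "f ` F"] \<open>F \<noteq> {}\<close> by auto
    define G where "G = {w \<in> F. f w = f z}"
    have "G face_of F"
      unfolding face_of_def
    proof (intro conjI ballI impI)
      show "G \<subseteq> F" by (auto simp: G_def)
      have "G = F \<inter> f -` {f z}" by (auto simp: G_def)
      then show "convex G"
        using \<open>convex F\<close> by (simp add: convex_Int convex_linear_vimage f.linear_axioms)
    next
      fix a b w assume ab: "a \<in> F" "b \<in> F" and w: "w \<in> G" "w \<in> open_segment a b"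
      from w(2) obtain u where u: "0 < u" "u < 1" "w = (1 - u) *\<^sub>R a + u *\<^sub>R b"
        by (auto simp: in_segment)
      with w(1) have "f z = (1 - u) * f a + u * f b"
        by (simp add: G_def f.add f.scaleR)
      then have sum: "(1 - u) * (f a - f z) + u * (f b - f z) = 0"
        by (simp add: algebra_simps)
      have "(1 - u) * (f a - f z) \<ge> 0" "u * (f b - f z) \<ge> 0"
        using ab z(2) u by simp_all
      with sum have "(1 - u) * (f a - f z) = 0" "u * (f b - f z) = 0" by linarith+
      with u ab show "a \<in> G" "b \<in> G" by (auto simp: G_def)
    qed
    then have "G face_of S" using face by (rule face_of_trans)
    moreover have "closed G"
    proof -
      have "closed {w. f w = f z}"
        by (intro closed_Collect_eq f.continuous_on continuous_on_id continuous_on_const)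
      then show ?thesis
        using \<open>closed F\<close> by (simp add: G_def Collect_conj_eq closed_Int)
    qed
    ultimately have "G \<in> \<F>" using z(1) by (auto simp: \<F>_def G_def)
    then have "G = F" by (rule minimal) (auto simp: G_def)
    with xy have "f x = f z" "f y = f z" by (auto simp: G_def)
    with f(2) show False by simp
  qed
  with \<open>F \<noteq> {}\<close> obtain e where "F = {e}" by blast
  with face that show thesis by (simp add: face_of_singleton)
qed

text \<open>Weak compactness of the unit part \<open>P \<inter> cball 0 1\<close> carries over to larger balls by dilation.\<close>

lemma reflexive_cone_closed_bounded_convex_weakly_compact:
  fixes P :: "'a::real_normed_vector set"
  assumes P: "reflexive_cone P" and C: "C \<subseteq> P" "closed C" "bounded C" "convex C"
  shows "compactin weak_topology C"
proof -
  from \<open>bounded C\<close> obtain R where R: "R > 0" "\<And>x. x \<in> C \<Longrightarrow> norm x \<le> R"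
    by (auto simp: bounded_pos)
  have cone: "convex_cone P" and compact: "compactin weak_topology (P \<inter> cball 0 1)"
    using P by (auto simp: reflexive_cone_def)
  have "C \<subseteq> (\<lambda>x. R *\<^sub>R x) ` (P \<inter> cball 0 1)"
  proof
    fix x assume x: "x \<in> C"
    have "(1 / R) *\<^sub>R x \<in> P"
      using cone C(1) x R(1) by (intro convex_cone_scaleR) auto
    moreover have "norm ((1 / R) *\<^sub>R x) \<le> 1"
      using R x by simp
    moreover have "x = R *\<^sub>R ((1 / R) *\<^sub>R x)" using R(1) by simp
    ultimately show "x \<in> (\<lambda>x. R *\<^sub>R x) ` (P \<inter> cball 0 1)" by (intro image_eqI) auto
  qed
  moreover have "compactin weak_topology ((\<lambda>x. R *\<^sub>R x) ` (P \<inter> cball 0 1))"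
    using compact continuous_map_weak_weak[OF bounded_linear_scaleR_right] by (rule image_compactin)
  ultimately show ?thesis
    using C(2,4) weakly_compact_closed_convex_subset by blast
qed

section \<open>Bases and extremal points of cones\<close>

lemma base_of_coneD:
  assumes "base_of_cone B K"
  shows "B \<subseteq> K" "convex B"
    and "x \<in> K \<Longrightarrow> x \<noteq> 0 \<Longrightarrow> \<exists>t>0. x /\<^sub>R t \<in> B"
    and "x \<in> K \<Longrightarrow> x \<noteq> 0 \<Longrightarrow> s > 0 \<Longrightarrow> t > 0 \<Longrightarrow> x /\<^sub>R s \<in> B \<Longrightarrow> x /\<^sub>R t \<in> B \<Longrightarrow> s = t"
proof -
  show "B \<subseteq> K" "convex B" using assms by (simp_all add: base_of_cone_def)
  show "\<exists>t>0. x /\<^sub>R t \<in> B" if "x \<in> K" "x \<noteq> 0"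
    using assms that unfolding base_of_cone_def by (meson ex1_implies_ex)
  show "s = t" if "x \<in> K" "x \<noteq> 0" "s > 0" "t > 0" "x /\<^sub>R s \<in> B" "x /\<^sub>R t \<in> B"
  proof -
    have "\<exists>!t. t > 0 \<and> x /\<^sub>R t \<in> B" using assms that(1,2) by (simp add: base_of_cone_def)
    with that(3-6) show ?thesis by (metis (no_types, lifting))
  qed
qed

lemma base_of_subcone:
  assumes B: "base_of_cone B P" and K: "K \<subseteq> P" "convex_cone K"
  shows "base_of_cone (B \<inter> K) K"
  unfolding base_of_cone_def
proof (intro conjI ballI impI)
  show "convex (B \<inter> K)"
    using base_of_coneD(2)[OF B] K(2) by (simp add: convex_Int convex_cone_def)
next
  fix x assume x: "x \<in> K" "x \<noteq> 0"
  have "x /\<^sub>R t \<in> K" if "t > 0" for t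
    using K(2) x that by (intro convex_cone_scaleR) auto
  moreover have "\<exists>!t. t > 0 \<and> x /\<^sub>R t \<in> B"
    using B x K(1) unfolding base_of_cone_def by blast
  ultimately show "\<exists>!t. t > 0 \<and> x /\<^sub>R t \<in> B \<inter> K" by blast
qed auto

text \<open>The zero cone is an exception, as \<open>{0}\<close> is a base of it. In any other cone, if \<open>0\<close> were in the
  base, then halving a base element would give a second base element on the same ray.\<close>

lemma zero_notin_base:
  assumes B: "base_of_cone B K" and x: "x \<in> K" "x \<noteq> 0"
  shows "0 \<notin> B"
proof
  assume "0 \<in> B"
  obtain t where t: "t > 0" "x /\<^sub>R t \<in> B" using base_of_coneD(3)[OF B x] by blast
  then have "(1 / 2) *\<^sub>R (x /\<^sub>R t) + (1 / 2) *\<^sub>R 0 \<in> B"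
    using \<open>0 \<in> B\<close> by (intro convexD[OF base_of_coneD(2)[OF B]]) auto
  then have "x /\<^sub>R (2 * t) \<in> B" by (simp add: mult.commute)
  then have "2 * t = t" using base_of_coneD(4)[OF B x, of "2 * t" t] t by simp
  with t show False by simp
qed

lemma cone_with_base_pointed:
  assumes B: "base_of_cone B K" and x: "x \<in> K" "- x \<in> K"
  shows "x = 0"
proof (rule ccontr)
  assume "x \<noteq> 0"
  obtain s where s: "s > 0" "x /\<^sub>R s \<in> B"
    using base_of_coneD(3)[OF B x(1) \<open>x \<noteq> 0\<close>] by blast
  obtain t where t: "t > 0" "(- x) /\<^sub>R t \<in> B"
    using base_of_coneD(3)[OF B x(2)] \<open>x \<noteq> 0\<close> by auto
  have "(s / (s + t)) *\<^sub>R (x /\<^sub>R s) + (t / (s + t)) *\<^sub>R ((- x) /\<^sub>R t) \<in> B"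
    using s t by (intro convexD[OF base_of_coneD(2)[OF B]]) (auto simp: add_divide_distrib[symmetric])
  also have "(s / (s + t)) *\<^sub>R (x /\<^sub>R s) + (t / (s + t)) *\<^sub>R ((- x) /\<^sub>R t) = 0"
    using s(1) t(1) by simp
  finally show False using zero_notin_base[OF B x(1) \<open>x \<noteq> 0\<close>] by simp
qed

text \<open>
  If \<open>x\<close> and \<open>e - x\<close> are nonzero elements of \<open>K\<close>, normalising both to the base writes \<open>e\<close> as a
  positive combination of base elements; uniqueness of the normalisation of \<open>e\<close> makes
  it a convex combination, so both base elements equal the extreme point \<open>e\<close>.
\<close>

lemma extreme_point_of_base_imp_extremal_point:
  assumes K: "convex_cone K" and B: "base_of_cone B K" and "B \<noteq> {0}"
    and e: "e extreme_point_of B"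
  shows "extremal_point K e"
proof -
  have eB: "e \<in> B" using e by (simp add: extreme_point_of_def)
  have eK: "e \<in> K" using eB base_of_coneD(1)[OF B] by blast
  have "0 \<notin> B"
    using eB \<open>B \<noteq> {0}\<close> zero_notin_base[OF B] base_of_coneD(1)[OF B] by blast
  with eB have "e \<noteq> 0" by auto
  have "\<exists>c. x = c *\<^sub>R e" if x: "x \<in> K" "e - x \<in> K" for x
  proof (cases "x = 0 \<or> e - x = 0")
    case True
    then show ?thesis by (auto intro: exI[of _ 0] exI[of _ 1])
  next
    case False
    obtain s where s: "s > 0" "x /\<^sub>R s \<in> B" using base_of_coneD(3)[OF B x(1)] False by blast
    obtain t where t: "t > 0" "(e - x) /\<^sub>R t \<in> B" using base_of_coneD(3)[OF B x(2)] False by blast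
    define u where "u = x /\<^sub>R s"
    define v where "v = (e - x) /\<^sub>R t"
    have uv: "u \<in> B" "v \<in> B" using s t by (auto simp: u_def v_def)
    have e_eq: "e = s *\<^sub>R u + t *\<^sub>R v" using s t by (simp add: u_def v_def)
    have "(s / (s + t)) *\<^sub>R u + (t / (s + t)) *\<^sub>R v \<in> B"
      using s(1) t(1) uv
      by (intro convexD[OF base_of_coneD(2)[OF B]]) (auto simp: add_divide_distrib[symmetric])
    also have "(s / (s + t)) *\<^sub>R u + (t / (s + t)) *\<^sub>R v = e /\<^sub>R (s + t)"
      by (simp add: e_eq scaleR_right_distrib divide_inverse mult.commute)
    finally have "s + t = 1"
      using base_of_coneD(4)[OF B eK \<open>e \<noteq> 0\<close>, of "s + t" 1] s(1) t(1) eB by simp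
    then have "1 - t = s" by simp
    then have "e = (1 - t) *\<^sub>R u + t *\<^sub>R v" and "t < 1"
      using e_eq s(1) by auto
    moreover have "e \<notin> open_segment u v"
      using e uv by (auto simp: extreme_point_of_def)
    ultimately have "u = v" using t(1) by (auto simp: in_segment)
    then have "e = (s + t) *\<^sub>R u" using e_eq by (metis scaleR_left_distrib)
    then have "e = u" using \<open>s + t = 1\<close> by simp
    then have "x = s *\<^sub>R e" using s(1) by (simp add: u_def)
    then show ?thesis ..
  qed
  then show ?thesis
    using eK \<open>e \<noteq> 0\<close> by (auto simp: extremal_point_def cone_le_def)
qed

text \<open>
  Successive subtraction of projections. Positivity keeps earlier projections zero: if \<open>\<pi> d w = 0\<close>
  and \<open>w = w' + \<pi> e w\<close> with both summands in \<open>K\<close>, then \<open>\<pi> d w'\<close> and \<open>\<pi> d (\<pi> e w)\<close> are elements of \<open>K\<close>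
  with sum \<open>0\<close>.
\<close>

lemma remainder_of_positive_projections:
  fixes \<pi> :: "'a::real_vector \<Rightarrow> 'a \<Rightarrow> 'a"
  assumes pointed: "\<And>x. x \<in> K \<Longrightarrow> - x \<in> K \<Longrightarrow> x = 0"
    and lin: "\<And>e. e \<in> F \<Longrightarrow> linear (\<pi> e)"
    and idem: "\<And>e x. e \<in> F \<Longrightarrow> \<pi> e (\<pi> e x) = \<pi> e x"
    and range: "\<And>e x. e \<in> F \<Longrightarrow> \<pi> e x \<in> span {e}"
    and pos: "\<And>e x. e \<in> F \<Longrightarrow> x \<in> K \<Longrightarrow> \<pi> e x \<in> K"
    and le: "\<And>e x. e \<in> F \<Longrightarrow> x \<in> K \<Longrightarrow> x - \<pi> e x \<in> K"
    and "finite F" "z \<in> K"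
  shows "\<exists>w\<in>K. z - w \<in> span F \<and> (\<forall>e\<in>F. \<pi> e w = 0)"
  using \<open>finite F\<close> lin idem range pos le
proof (induction F rule: finite_induct)
  case empty
  then show ?case using \<open>z \<in> K\<close> by (intro bexI[of _ z]) auto
next
  case (insert e F)
  have "\<exists>w\<in>K. z - w \<in> span F \<and> (\<forall>d\<in>F. \<pi> d w = 0)"
    by (rule insert.IH) (use insert.prems in auto)
  then obtain w where w: "w \<in> K" "z - w \<in> span F" "\<And>d. d \<in> F \<Longrightarrow> \<pi> d w = 0"
    by blast
  define w' where "w' = w - \<pi> e w"
  have w'K: "w' \<in> K" and eK: "\<pi> e w \<in> K"
    using insert.prems w(1) by (auto simp: w'_def)
  have "z - w' \<in> span (insert e F)"
  proof -
    have "z - w \<in> span (insert e F)" "\<pi> e w \<in> span (insert e F)"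
      using w(2) insert.prems(3)[of e w] span_mono[of F "insert e F"] span_mono[of "{e}" "insert e F"]
      by auto
    then have "(z - w) + \<pi> e w \<in> span (insert e F)" by (rule span_add)
    then show ?thesis by (simp add: w'_def algebra_simps)
  qed
  moreover have "\<pi> e w' = 0"
    using linear_diff[OF insert.prems(1), of e w "\<pi> e w"] insert.prems(2)[of e w]
    by (simp add: w'_def)
  moreover have "\<pi> d w' = 0" if d: "d \<in> F" for d
  proof (rule pointed)
    show "\<pi> d w' \<in> K" using insert.prems(4) d w'K by simp
    have "\<pi> d w' = - \<pi> d (\<pi> e w)"
      using linear_diff[OF insert.prems(1), of d w "\<pi> e w"] d w(3) by (simp add: w'_def)
    then show "- \<pi> d w' \<in> K" using insert.prems(4)[of d "\<pi> e w"] d eK by simp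
  qed
  ultimately show ?case using w'K by (intro bexI[of _ w']) auto
qed

section \<open>Cones with the continuous projection property\<close>

text \<open>
  The set \<open>D\<close> below, where all projections onto extremal rays vanish, is a closed face of the base
  without extreme points, hence empty. Compactness turns this into finitely many projections whose
  kernels meet \<open>K\<close> only in \<open>0\<close>.
\<close>

lemma cone_with_weakly_compact_base_finite_dimensional:
  fixes K :: "'a::real_normed_vector set"
  assumes K: "convex_cone K" and C: "base_of_cone C K"
    and compact: "compactin weak_topology C" and "closed C"
    and cpp: "continuous_projection_property K"
  shows "\<not> infinite_dimensional_cone K"
proof (cases "K = {0}")
  case True
  then have "finite {}" "{x - y | x y. x \<in> K \<and> y \<in> K} \<subseteq> span {}" by auto
  then show ?thesis unfolding infinite_dimensional_cone_def by blast
next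
  case False
  then obtain k where "k \<in> K" "k \<noteq> 0"
    using convex_cone_contains_0[OF K] by blast
  then have "0 \<notin> C" using zero_notin_base[OF C] by blast
  note C_sub = base_of_coneD(1)[OF C] and C_convex = base_of_coneD(2)[OF C]
  note pointed = cone_with_base_pointed[OF C]
  define E where "E = {e. e extreme_point_of C}"
  have "\<exists>p. bounded_linear p \<and> (\<forall>x. p (p x) = p x) \<and> range p = span {e} \<and>
            (\<forall>x\<in>K. p x \<in> K \<and> x - p x \<in> K)" if "e \<in> E" for e
  proof -
    have "extremal_point K e"
      using extreme_point_of_base_imp_extremal_point[OF K C] \<open>0 \<notin> C\<close> that by (auto simp: E_def)
    then have "admits_positive_projection K e"
      using cpp by (simp add: continuous_projection_property_def)
    then show ?thesis
      unfolding admits_positive_projection_def cone_le_def o_def fun_eq_iff by blast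
  qed
  then have "\<forall>e\<in>E. \<exists>p. bounded_linear p \<and> (\<forall>x. p (p x) = p x) \<and> range p = span {e} \<and>
            (\<forall>x\<in>K. p x \<in> K \<and> x - p x \<in> K)" ..
  from bchoice[OF this]
  obtain \<pi> where \<pi>: "\<And>e. e \<in> E \<Longrightarrow> bounded_linear (\<pi> e)" "\<And>e x. e \<in> E \<Longrightarrow> \<pi> e (\<pi> e x) = \<pi> e x"
      "\<And>e. e \<in> E \<Longrightarrow> range (\<pi> e) = span {e}"
      "\<And>e x. e \<in> E \<Longrightarrow> x \<in> K \<Longrightarrow> \<pi> e x \<in> K" "\<And>e x. e \<in> E \<Longrightarrow> x \<in> K \<Longrightarrow> x - \<pi> e x \<in> K"
    by blast
  have kernel_closed: "closed (\<pi> e -` {0})" and kernel_convex: "convex (\<pi> e -` {0})"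
    if "e \<in> E" for e
    using \<pi>(1)[OF that]
    by (auto intro!: continuous_closed_vimage convex_linear_vimage
        simp: bounded_linear.linear linear_continuous_at)
  define D where "D = C \<inter> (\<Inter>e\<in>E. \<pi> e -` {0})"
  have "D face_of C"
    unfolding face_of_def
  proof (intro conjI ballI impI)
    show "D \<subseteq> C" by (auto simp: D_def)
    show "convex D"
      unfolding D_def using C_convex kernel_convex by (intro convex_Int convex_INT) auto
  next
    fix a b x assume ab: "a \<in> C" "b \<in> C" and x: "x \<in> D" "x \<in> open_segment a b"
    from x(2) obtain u where u: "0 < u" "u < 1" "x = (1 - u) *\<^sub>R a + u *\<^sub>R b"
      by (auto simp: in_segment)
    have "\<pi> e a = 0 \<and> \<pi> e b = 0" if e: "e \<in> E" for e
    proof -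
      interpret bounded_linear "\<pi> e" by (rule \<pi>(1)[OF e])
      have abK: "(1 - u) *\<^sub>R \<pi> e a \<in> K" "u *\<^sub>R \<pi> e b \<in> K"
        using ab C_sub u \<pi>(4)[OF e] by (auto intro!: convex_cone_scaleR[OF K])
      have "(1 - u) *\<^sub>R \<pi> e a + u *\<^sub>R \<pi> e b = 0"
        using x(1) e add[of "(1 - u) *\<^sub>R a" "u *\<^sub>R b"] by (simp add: D_def u(3) scaleR)
      then have "- ((1 - u) *\<^sub>R \<pi> e a) = u *\<^sub>R \<pi> e b"
        by (rule minus_unique)
      with abK have zero: "(1 - u) *\<^sub>R \<pi> e a = 0"
        by (intro pointed) simp_all
      with \<open>(1 - u) *\<^sub>R \<pi> e a + u *\<^sub>R \<pi> e b = 0\<close> have "u *\<^sub>R \<pi> e b = 0" by simp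
      with zero u show ?thesis by auto
    qed
    then show "a \<in> D" "b \<in> D" using ab by (auto simp: D_def)
  qed
  have "D = {}"
  proof (rule ccontr)
    assume "D \<noteq> {}"
    have "D \<subseteq> C" "convex D" using \<open>D face_of C\<close> by (auto dest: face_of_imp_subset face_of_imp_convex)
    have "closed D"
      unfolding D_def using \<open>closed C\<close> kernel_closed by (intro closed_Int closed_INT) auto
    then have "compactin weak_topology D"
      using weakly_compact_closed_convex_subset[OF compact] \<open>D \<subseteq> C\<close> \<open>convex D\<close> by blast
    then obtain e where "e extreme_point_of D"
      using weakly_compact_convex_has_extreme_point \<open>closed D\<close> \<open>convex D\<close> \<open>D \<noteq> {}\<close> by blast
    then have e: "e \<in> E" "e \<in> D"
      using extreme_point_of_face[OF \<open>D face_of C\<close>] by (auto simp: E_def)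
    \<comment> \<open>\<open>\<pi> e\<close> fixes \<open>e\<close> because \<open>e\<close> lies in its range.\<close>
    have "e \<in> range (\<pi> e)" using \<pi>(3)[OF e(1)] by (simp add: span_base)
    then obtain x where "e = \<pi> e x" by blast
    then have "\<pi> e e = e" using \<pi>(2)[OF e(1), of x] by simp
    with e \<open>0 \<notin> C\<close> show False by (auto simp: D_def)
  qed
  obtain F where F: "finite F" "F \<subseteq> E" "C \<inter> (\<Inter>e\<in>F. \<pi> e -` {0}) = {}"
  proof -
    have "closedin weak_topology N" if "N \<in> (\<lambda>e. \<pi> e -` {0}) ` E" for N
      using that kernel_closed kernel_convex closed_convex_imp_weakly_closed by blast
    moreover have "C \<inter> \<Inter>((\<lambda>e. \<pi> e -` {0}) ` E) = {}" using \<open>D = {}\<close> by (simp add: D_def)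
    ultimately obtain \<N> where "finite \<N>" "\<N> \<subseteq> (\<lambda>e. \<pi> e -` {0}) ` E" "C \<inter> \<Inter>\<N> = {}"
      using compact unfolding compactin_fip by meson
    then show thesis using that finite_subset_image[of \<N> "\<lambda>e. \<pi> e -` {0}" E] by metis
  qed
  have "z \<in> span F" if "z \<in> K" for z
  proof -
    have "\<pi> e x \<in> span {e}" if "e \<in> F" for e x
      using that F(2) \<pi>(3)[of e] by blast
    then have "\<exists>w\<in>K. z - w \<in> span F \<and> (\<forall>e\<in>F. \<pi> e w = 0)"
      using F(1,2) \<pi>(1,2,4,5) that
      by (intro remainder_of_positive_projections[OF pointed]) (auto simp: bounded_linear.linear)
    then obtain w where w: "w \<in> K" "z - w \<in> span F" "\<And>e. e \<in> F \<Longrightarrow> \<pi> e w = 0" by blast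
    \<comment> \<open>Otherwise \<open>w\<close>, scaled into the base, would lie in the kernels of all projections for \<open>F\<close>.\<close>
    have "w = 0"
    proof (rule ccontr)
      assume "w \<noteq> 0"
      then obtain t where "w /\<^sub>R t \<in> C" using base_of_coneD(3)[OF C w(1)] by blast
      moreover have "\<pi> e (w /\<^sub>R t) = 0" if "e \<in> F" for e
        using that F(2) w(3) \<pi>(1)[of e] by (auto simp: bounded_linear.linear linear_scale)
      ultimately show False using F(3) by auto
    qed
    with w(2) show ?thesis by simp
  qed
  then have "{x - y | x y. x \<in> K \<and> y \<in> K} \<subseteq> span F"
    by (auto intro: span_diff)
  then show ?thesis
    unfolding infinite_dimensional_cone_def using F(1) by blast
qed

theorem theorem7p3:
  fixes P B :: "'a::banach set"
  assumes "reflexive_cone P"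
    and "base_of_cone B P" and "closed B" and "bounded B"
  shows "\<not> (\<exists>K. K \<subseteq> P \<and> convex_cone K \<and> closed K \<and>
               infinite_dimensional_cone K \<and> continuous_projection_property K)"
proof clarify
  fix K assume K: "K \<subseteq> P" "convex_cone K" "closed K"
    and "infinite_dimensional_cone K" "continuous_projection_property K"
  have base: "base_of_cone (B \<inter> K) K"
    using base_of_subcone[OF assms(2) K(1,2)] .
  moreover have "closed (B \<inter> K)" using assms(3) K(3) by (rule closed_Int)
  moreover from this have "compactin weak_topology (B \<inter> K)"
    using K(1) base_of_coneD(2)[OF base] bounded_subset[OF assms(4), of "B \<inter> K"]
    by (intro reflexive_cone_closed_bounded_convex_weakly_compact[OF assms(1)]) auto
  ultimately have "\<not> infinite_dimensional_cone K"
    using cone_with_weakly_compact_base_finite_dimensional[OF K(2)]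
      \<open>continuous_projection_property K\<close> by blast
  with \<open>infinite_dimensional_cone K\<close> show False by contradiction
qed

end
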